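(* Let $\mathfrak{L}$ be an infinite set and let $\mathcal{U}$ be a free ultrafilter on $\mathfrak{L}$. Then there exists a Hausdorff topological space $(\mathbb{R}_{\mathfrak{L}},\tau)$, with $\mathfrak{L}\times\mathbb{R}\subseteq\mathbb{R}_{\mathfrak{L}}$, such that: 1. $\mathbb{R}_{\mathfrak{L}}=\mathrm{cl}_{\tau}(\mathfrak{L}\times\mathbb{R})$; 2. $\mathbb{R}\subseteq\mathbb{R}_{\mathfrak{L}}$ and for every $c\in\mathbb{R}$, $\lim_{\lambda\to\Lambda}(\lambda,c)=c$; 3. for every function $\varphi:\mathfrak{L}\to\mathbb{R}$ the limit $\lim_{\lambda\to\Lambda}(\lambda,\varphi(\lambda))$ exists in $(\mathbb{R}_{\mathfrak{L}},\tau)$; 4. two functions $\varphi,\psi:\mathfrak{L}\to\mathbb{R}$ are eventually equal if and only if $\lim_{\lambda\to\Lambda}(\lambda,\varphi(\lambda))=\lim_{\lambda\to\Lambda}(\lambda,\psi(\lambda))$.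
   Context: Sets $Q\in\mathcal{U}$ are called qualified. A property holds "eventually" (in $\lambda$) if it holds for all $\lambda$ in some qualified set; in particular $\varphi,\psi$ are eventually equal if there is $Q\in\mathcal{U}$ with $\varphi(\lambda)=\psi(\lambda)$ for all $\lambda\in Q$. For a Hausdorff space $X$, a function $\Phi:\mathfrak{L}\to X$ and $x_0\in X$, one writes $\lim_{\lambda\to\Lambda}\Phi(\lambda)=x_0$ (the $\Lambda$-limit) if for every neighborhood $V$ of $x_0$ there is $Q\in\mathcal{U}$ with $\Phi(Q)\subseteq V$. The notation $\lim_{\lambda\to\Lambda}(\lambda,\varphi(\lambda))$ is the $\Lambda$-limit of the function $\lambda\mapsto(\lambda,\varphi(\lambda))\in\mathfrak{L}\times\mathbb{R}\subseteq\mathbb{R}_{\mathfrak{L}}$. In item 2, $\mathbb{R}\subseteq\mathbb{R}_{\mathfrak{L}}$ means that $\mathbb{R}$ is identified with a subset of $\mathbb{R}_{\mathfrak{L}}$ (via an injective map). *)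

theory Defs
  imports "HOL-Analysis.Analysis"
begin

(* An ultrafilter on a set L is encoded as a filter F on the ambient type concentrated on L:
   its members are the sets Q with "eventually (\<lambda>x. x \<in> Q) F", and L is one of them.
   Freeness says that the members of F have empty intersection. *)
definition free_ultrafilter_on :: "'l set \<Rightarrow> 'l filter \<Rightarrow> bool" where
  "free_ultrafilter_on L F \<longleftrightarrow>
     F \<noteq> bot \<and> F \<le> principal L \<and>
     (\<forall>P. eventually P F \<or> eventually (\<lambda>x. \<not> P x) F) \<and>
     \<Inter>{Q. eventually (\<lambda>x. x \<in> Q) F} = {}"

(* The encoding is equivalent to the usual one by a system of subsets of L: the next two lemmas
   give the two directions, and the last two express "eventually" and limits in terms of the
   members Q of the ultrafilter. *)
lemma free_ultrafilter_on_members: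
  assumes "free_ultrafilter_on L F"
  defines "\<U> \<equiv> {Q. Q \<subseteq> L \<and> eventually (\<lambda>x. x \<in> Q) F}"
  shows "L \<in> \<U>" and "{} \<notin> \<U>"
    and "A \<in> \<U> \<Longrightarrow> B \<in> \<U> \<Longrightarrow> A \<inter> B \<in> \<U>"
    and "A \<in> \<U> \<Longrightarrow> A \<subseteq> B \<Longrightarrow> B \<subseteq> L \<Longrightarrow> B \<in> \<U>"
    and "A \<subseteq> L \<Longrightarrow> A \<in> \<U> \<or> L - A \<in> \<U>"
    and "\<Inter>\<U> = {}"
proof -
  have L: "eventually (\<lambda>x. x \<in> L) F"
    using assms(1) unfolding free_ultrafilter_on_def by (simp add: le_principal)
  show "L \<in> \<U>"
    using L by (simp add: \<U>_def)
  show "{} \<notin> \<U>"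
    using assms(1) by (auto simp: \<U>_def free_ultrafilter_on_def)
  show "A \<in> \<U> \<Longrightarrow> B \<in> \<U> \<Longrightarrow> A \<inter> B \<in> \<U>"
    by (auto simp: \<U>_def eventually_conj_iff)
  show "A \<in> \<U> \<Longrightarrow> A \<subseteq> B \<Longrightarrow> B \<subseteq> L \<Longrightarrow> B \<in> \<U>"
    by (auto simp: \<U>_def elim!: eventually_mono)
  show "A \<in> \<U> \<or> L - A \<in> \<U>" if "A \<subseteq> L"
  proof -
    have "eventually (\<lambda>x. x \<in> A) F \<or> eventually (\<lambda>x. x \<notin> A) F"
      using assms(1) unfolding free_ultrafilter_on_def by blast
    with L that show ?thesis
      by (auto simp: \<U>_def eventually_conj_iff)
  qed
  have "x \<notin> \<Inter>\<U>" for x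
  proof -
    obtain Q where Q: "eventually (\<lambda>x. x \<in> Q) F" "x \<notin> Q"
      using assms(1) unfolding free_ultrafilter_on_def by blast
    then have "Q \<inter> L \<in> \<U>"
      using L by (auto simp: \<U>_def eventually_conj_iff)
    with Q show ?thesis by blast
  qed
  then show "\<Inter>\<U> = {}" by blast
qed

lemma free_ultrafilter_on_of_members:
  assumes sub: "\<U> \<subseteq> Pow L" and L: "L \<in> \<U>" and empty: "{} \<notin> \<U>"
    and int: "\<And>A B. A \<in> \<U> \<Longrightarrow> B \<in> \<U> \<Longrightarrow> A \<inter> B \<in> \<U>"
    and up: "\<And>A B. A \<in> \<U> \<Longrightarrow> A \<subseteq> B \<Longrightarrow> B \<subseteq> L \<Longrightarrow> B \<in> \<U>"
    and ultra: "\<And>A. A \<subseteq> L \<Longrightarrow> A \<in> \<U> \<or> L - A \<in> \<U>"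
    and free: "\<Inter>\<U> = {}"
  shows "\<exists>F. free_ultrafilter_on L F \<and> \<U> = {Q. Q \<subseteq> L \<and> eventually (\<lambda>x. x \<in> Q) F}"
proof -
  define F where "F = Abs_filter (\<lambda>P. {x \<in> L. P x} \<in> \<U>)"
  have "is_filter (\<lambda>P. {x \<in> L. P x} \<in> \<U>)"
  proof
    show "{x \<in> L. True} \<in> \<U>" using L by simp
    show "{x \<in> L. P x \<and> Q x} \<in> \<U>" if "{x \<in> L. P x} \<in> \<U>" "{x \<in> L. Q x} \<in> \<U>" for P Q
    proof -
      have "{x \<in> L. P x \<and> Q x} = {x \<in> L. P x} \<inter> {x \<in> L. Q x}" by blast
      with int[OF that] show ?thesis by simp
    qed
    show "{x \<in> L. Q x} \<in> \<U>" if "\<forall>x. P x \<longrightarrow> Q x" "{x \<in> L. P x} \<in> \<U>" for P Q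
      using that by (intro up[OF that(2)]) auto
  qed
  then have ev: "eventually P F \<longleftrightarrow> {x \<in> L. P x} \<in> \<U>" for P
    unfolding F_def by (rule eventually_Abs_filter)
  have ev_mem: "eventually (\<lambda>x. x \<in> Q) F \<longleftrightarrow> Q \<in> \<U>" if "Q \<subseteq> L" for Q
  proof -
    have "{x \<in> L. x \<in> Q} = Q" using that by blast
    then show ?thesis by (simp add: ev)
  qed
  have "F \<noteq> bot"
  proof
    assume "F = bot"
    then have "eventually (\<lambda>x. False) F" by simp
    then show False using empty by (simp add: ev)
  qed
  moreover have "F \<le> principal L"
    using L by (simp add: le_principal ev_mem)
  moreover have "eventually P F \<or> eventually (\<lambda>x. \<not> P x) F" for P
  proof -
    have "L - {x \<in> L. P x} = {x \<in> L. \<not> P x}" by blast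
    then show ?thesis using ultra[of "{x \<in> L. P x}"] by (auto simp: ev)
  qed
  moreover have "\<Inter>{Q. eventually (\<lambda>x. x \<in> Q) F} = {}"
  proof -
    have "\<U> \<subseteq> {Q. eventually (\<lambda>x. x \<in> Q) F}" using sub ev_mem by blast
    with free show ?thesis by blast
  qed
  moreover have "\<U> = {Q. Q \<subseteq> L \<and> eventually (\<lambda>x. x \<in> Q) F}"
    using sub ev_mem by blast
  ultimately show ?thesis
    unfolding free_ultrafilter_on_def by blast
qed

lemma eventually_iff_qualified:
  assumes "F \<le> principal L"
  shows "eventually P F \<longleftrightarrow> (\<exists>Q\<subseteq>L. eventually (\<lambda>x. x \<in> Q) F \<and> (\<forall>x\<in>Q. P x))"
proof
  assume "eventually P F"
  moreover have "eventually (\<lambda>x. x \<in> L) F"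
    using assms by (simp add: le_principal)
  ultimately have "eventually (\<lambda>x. x \<in> {x \<in> L. P x}) F"
    by (simp add: eventually_conj_iff)
  then show "\<exists>Q\<subseteq>L. eventually (\<lambda>x. x \<in> Q) F \<and> (\<forall>x\<in>Q. P x)"
    by (intro exI[of _ "{x \<in> L. P x}"]) auto
qed (auto elim!: eventually_mono)

lemma limitin_iff_qualified:
  assumes "F \<le> principal L"
  shows "limitin X \<Phi> x F \<longleftrightarrow>
    x \<in> topspace X \<and>
    (\<forall>V. (\<exists>W. openin X W \<and> x \<in> W \<and> W \<subseteq> V) \<longrightarrow>
       (\<exists>Q\<subseteq>L. eventually (\<lambda>l. l \<in> Q) F \<and> \<Phi> ` Q \<subseteq> V))"
proof -
  have "(\<exists>Q\<subseteq>L. eventually (\<lambda>l. l \<in> Q) F \<and> \<Phi> ` Q \<subseteq> V) \<longleftrightarrow> eventually (\<lambda>l. \<Phi> l \<in> V) F" for V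
    unfolding eventually_iff_qualified[OF assms, of "\<lambda>l. \<Phi> l \<in> V"] by (simp add: image_subset_iff)
  then show ?thesis
    unfolding limitin_def by (auto elim!: eventually_mono)
qed

(* HOL cannot quantify existentially over types. A space that is to contain L \<times> \<real> and the
   limits of functions on L is therefore asserted to exist as a topology on the type
   'l \<times> real + ('l \<Rightarrow> real) set, where Inl is the inclusion of L \<times> \<real> and Inr leaves room for
   one further point per class of functions. *)

end

(* Adjoin to the discrete set L \<times> \<real> one point for every germ of a function along the filter,
   and let the sets of graph points (l, \<phi> l), for l in a qualified set, be the punctured
   neighbourhoods of the germ of \<phi>. The ultrafilter property separates distinct germs, because
   functions that are not eventually equal are eventually different; freeness separates a germ
   from the points of L \<times> \<real>. *)

theory Submission
  imports Defs
begin

text \<open>The class of \<open>\<phi>\<close> modulo eventual equality. For an ultrafilter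
  \<open>F\<close>, \<open>range (germ F)\<close> is the ultrapower of \<open>'a\<close> along
  \<open>F\<close>.\<close>

definition germ :: "'l filter \<Rightarrow> ('l \<Rightarrow> 'a) \<Rightarrow> ('l \<Rightarrow> 'a) set" where
  "germ F \<phi> = {\<psi>. eventually (\<lambda>l. \<phi> l = \<psi> l) F}"

lemma germ_eq_iff: "germ F \<phi> = germ F \<psi> \<longleftrightarrow> eventually (\<lambda>l. \<phi> l = \<psi> l) F"
proof
  assume "germ F \<phi> = germ F \<psi>"
  moreover have "\<psi> \<in> germ F \<psi>" by (simp add: germ_def)
  ultimately show "eventually (\<lambda>l. \<phi> l = \<psi> l) F" by (auto simp: germ_def)
next
  assume "eventually (\<lambda>l. \<phi> l = \<psi> l) F"
  then show "germ F \<phi> = germ F \<psi>"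
    by (auto simp: germ_def elim: eventually_elim2)
qed

definition germ_space :: "'l set \<Rightarrow> 'l filter \<Rightarrow> ('l \<times> 'a + ('l \<Rightarrow> 'a) set) set" where
  "germ_space L F = Inl ` (L \<times> UNIV) \<union> Inr ` range (germ F)"

text \<open>Quantifying over all \<open>\<phi>\<close> tests every representative of a germ in
  \<open>U\<close>, which avoids a choice. Representatives of one germ agree eventually and so
  impose the same condition. Points \<open>Inl p\<close> carry no condition and are
  isolated.\<close>

definition germ_open ::
    "'l set \<Rightarrow> 'l filter \<Rightarrow> ('l \<times> 'a + ('l \<Rightarrow> 'a) set) set \<Rightarrow> bool" where
  "germ_open L F U \<longleftrightarrow> U \<subseteq> germ_space L F \<and>
     (\<forall>\<phi>. Inr (germ F \<phi>) \<in> U \<longrightarrow> eventually (\<lambda>l. Inl (l, \<phi> l) \<in> U) F)"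

definition germ_topology :: "'l set \<Rightarrow> 'l filter \<Rightarrow> ('l \<times> 'a + ('l \<Rightarrow> 'a) set) topology" where
  "germ_topology L F = topology (germ_open L F)"

lemma istopology_germ_open: "istopology (germ_open L F)"
  unfolding istopology_def
proof (intro conjI allI impI)
  show "germ_open L F (U \<inter> V)" if "germ_open L F U" "germ_open L F V" for U V
    using that by (auto simp: germ_open_def eventually_conj_iff)
next
  fix K assume K: "\<forall>U\<in>K. germ_open L F U"
  show "germ_open L F (\<Union>K)"
    unfolding germ_open_def
  proof (intro conjI allI impI)
    show "\<Union>K \<subseteq> germ_space L F" using K by (auto simp: germ_open_def)
    fix \<phi> assume "Inr (germ F \<phi>) \<in> \<Union>K"
    then obtain U where "U \<in> K" "Inr (germ F \<phi>) \<in> U" by blast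
    with K have "eventually (\<lambda>l. Inl (l, \<phi> l) \<in> U) F" by (auto simp: germ_open_def)
    then show "eventually (\<lambda>l. Inl (l, \<phi> l) \<in> \<Union>K) F"
      by eventually_elim (use \<open>U \<in> K\<close> in blast)
  qed
qed

lemma openin_germ_topology: "openin (germ_topology L F) U \<longleftrightarrow> germ_open L F U"
  unfolding germ_topology_def topology_inverse'[OF istopology_germ_open] ..

lemma openin_germ_topology_discrete:
  "A \<subseteq> L \<times> UNIV \<Longrightarrow> openin (germ_topology L F) (Inl ` A)"
  by (auto simp: openin_germ_topology germ_open_def germ_space_def)

text \<open>These are the basic neighbourhoods of a germ. Any other representative
  \<open>\<psi>\<close> of the germ agrees with \<open>\<phi>\<close> on a qualified set, so its
  graph also eventually runs inside the set.\<close>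

lemma openin_germ_topology_graph:
  assumes "A \<subseteq> L" "eventually (\<lambda>l. l \<in> A) F"
  shows "openin (germ_topology L F) (insert (Inr (germ F \<phi>)) (Inl ` (\<lambda>l. (l, \<phi> l)) ` A))"
  unfolding openin_germ_topology germ_open_def
proof (intro conjI allI impI)
  show "insert (Inr (germ F \<phi>)) (Inl ` (\<lambda>l. (l, \<phi> l)) ` A) \<subseteq> germ_space L F"
    using assms(1) by (auto simp: germ_space_def)
  fix \<psi>
  assume "Inr (germ F \<psi>) \<in> insert (Inr (germ F \<phi>)) (Inl ` (\<lambda>l. (l, \<phi> l)) ` A)"
  then have "eventually (\<lambda>l. \<psi> l = \<phi> l) F" by (auto simp: germ_eq_iff)
  with assms(2)
  show "eventually (\<lambda>l. Inl (l, \<psi> l) \<in> insert (Inr (germ F \<phi>)) (Inl ` (\<lambda>l. (l, \<phi> l)) ` A)) F"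
    by eventually_elim auto
qed

lemma topspace_germ_topology:
  assumes "F \<le> principal L"
  shows "topspace (germ_topology L F) = germ_space L F" (is "topspace ?X = ?S")
proof (rule antisym)
  have "germ_open L F (topspace ?X)"
    using openin_topspace by (simp flip: openin_germ_topology)
  then show "topspace ?X \<subseteq> ?S"
    by (simp add: germ_open_def)
  \<comment> \<open>The whole space is open because \<open>F\<close> is concentrated on
    \<open>L\<close>, so that every graph eventually stays over \<open>L\<close>.\<close>
  have "eventually (\<lambda>l. Inl (l, \<phi> l) \<in> ?S) F" for \<phi>
    using assms unfolding le_principal by eventually_elim (auto simp: germ_space_def)
  then have "openin ?X ?S"
    by (simp add: openin_germ_topology germ_open_def)
  then show "?S \<subseteq> topspace ?X"
    by (rule openin_subset)
qed

lemma limitin_germ: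
  assumes "F \<le> principal L"
  shows "limitin (germ_topology L F) (\<lambda>l. Inl (l, \<phi> l)) (Inr (germ F \<phi>)) F"
  using assms
  by (auto simp: limitin_def topspace_germ_topology germ_space_def openin_germ_topology germ_open_def)

text \<open>Each germ is the limit of its graph, and \<open>F \<noteq> bot\<close> turns "eventually
  in \<open>T\<close>" into an actual graph point over \<open>L\<close> inside
  \<open>T\<close>.\<close>

lemma closure_of_germ_topology:
  assumes "F \<noteq> bot" "F \<le> principal L"
  shows "germ_topology L F closure_of (Inl ` (L \<times> UNIV)) = germ_space L F"
    (is "?X closure_of ?A = ?S")
proof (rule antisym)
  show "?X closure_of ?A \<subseteq> ?S"
    using closure_of_subset_topspace[of ?X] by (simp add: topspace_germ_topology[OF assms(2)])
  have "Inr (germ F \<phi>) \<in> ?X closure_of ?A" for \<phi>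
    unfolding in_closure_of
  proof (intro conjI allI impI)
    show "Inr (germ F \<phi>) \<in> topspace ?X"
      using limitin_germ[OF assms(2)] by (rule limitin_topspace)
    fix T assume "Inr (germ F \<phi>) \<in> T \<and> openin ?X T"
    then have "eventually (\<lambda>l. Inl (l, \<phi> l) \<in> T) F"
      by (simp add: openin_germ_topology germ_open_def)
    moreover have "eventually (\<lambda>l. l \<in> L) F"
      using assms(2) by (simp add: le_principal)
    ultimately have "eventually (\<lambda>l. l \<in> L \<and> Inl (l, \<phi> l) \<in> T) F"
      by eventually_elim simp
    then show "\<exists>y. y \<in> ?A \<and> y \<in> T"
      using eventually_happens'[OF assms(1)] by blast
  qed
  moreover have "?A \<subseteq> ?X closure_of ?A"
    by (rule closure_of_subset) (auto simp: topspace_germ_topology[OF assms(2)] germ_space_def)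
  ultimately show "?S \<subseteq> ?X closure_of ?A"
    by (auto simp: germ_space_def)
qed

lemma Hausdorff_germ_topology:
  assumes "free_ultrafilter_on L F"
  shows "Hausdorff_space (germ_topology L F :: ('l \<times> 'a + ('l \<Rightarrow> 'a) set) topology)"
proof -
  let ?X = "germ_topology L F :: ('l \<times> 'a + ('l \<Rightarrow> 'a) set) topology"
  have L: "F \<le> principal L" "eventually (\<lambda>l. l \<in> L) F"
    using assms by (auto simp: free_ultrafilter_on_def le_principal)
  have ultra: "eventually P F \<or> eventually (\<lambda>l. \<not> P l) F" for P
    using assms by (simp add: free_ultrafilter_on_def)
  \<comment> \<open>Since the members of \<open>F\<close> have empty intersection, some member
    misses \<open>a\<close>.\<close>
  have free: "eventually (\<lambda>l. l \<noteq> a) F" for a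
  proof -
    obtain Q where "eventually (\<lambda>l. l \<in> Q) F" "a \<notin> Q"
      using assms unfolding free_ultrafilter_on_def by blast
    then show ?thesis by (auto elim: eventually_mono)
  qed
  define sep where "sep x y \<longleftrightarrow>
    (\<exists>U V. openin ?X U \<and> openin ?X V \<and> x \<in> U \<and> y \<in> V \<and> disjnt U V)" for x y
  have sep_sym: "sep x y" if "sep y x" for x y
    using that unfolding sep_def by (metis disjnt_sym)
  have pp: "sep (Inl p) (Inl q)" if "p \<in> L \<times> UNIV" "q \<in> L \<times> UNIV" "p \<noteq> q" for p q
    unfolding sep_def using that
    by (intro exI[of _ "Inl ` {p}"] exI[of _ "Inl ` {q}"] conjI openin_germ_topology_discrete)
       (auto simp: disjnt_def)
  have pg: "sep (Inl p) (Inr (germ F \<phi>))" if "p \<in> L \<times> UNIV" for p \<phi>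
  proof -
    \<comment> \<open>A graph over \<open>L - {fst p}\<close> avoids \<open>p\<close>, whatever the
      second component of \<open>p\<close> is.\<close>
    have "eventually (\<lambda>l. l \<in> L - {fst p}) F"
      using L(2) free[of "fst p"] by eventually_elim simp
    then show ?thesis
      unfolding sep_def using that
      by (intro exI[of _ "Inl ` {p}"] conjI openin_germ_topology_discrete
          exI[of _ "insert (Inr (germ F \<phi>)) (Inl ` (\<lambda>l. (l, \<phi> l)) ` (L - {fst p}))"]
          openin_germ_topology_graph) (auto simp: disjnt_def)
  qed
  have gg: "sep (Inr (germ F \<phi>)) (Inr (germ F \<psi>))" if "germ F \<phi> \<noteq> germ F \<psi>" for \<phi> \<psi>
  proof -
    have "eventually (\<lambda>l. \<phi> l \<noteq> \<psi> l) F"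
      using that ultra germ_eq_iff by blast
    \<comment> \<open>Over this set the two graphs are disjoint: a common point would have a single
      first component \<open>l\<close> with \<open>\<phi> l = \<psi> l\<close>.\<close>
    with L(2) have "eventually (\<lambda>l. l \<in> {l \<in> L. \<phi> l \<noteq> \<psi> l}) F"
      by eventually_elim simp
    then show ?thesis
      unfolding sep_def using that
      by (intro conjI openin_germ_topology_graph
          exI[of _ "insert (Inr (germ F \<phi>)) (Inl ` (\<lambda>l. (l, \<phi> l)) ` {l \<in> L. \<phi> l \<noteq> \<psi> l})"]
          exI[of _ "insert (Inr (germ F \<psi>)) (Inl ` (\<lambda>l. (l, \<psi> l)) ` {l \<in> L. \<phi> l \<noteq> \<psi> l})"])
        (auto simp: disjnt_def)
  qed
  have "sep x y" if "x \<in> germ_space L F" "y \<in> germ_space L F" "x \<noteq> y" for x y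
    using that(1,2) unfolding germ_space_def
    by (elim UnE imageE; use that(3) in \<open>auto intro!: pp pg gg sep_sym[OF pg]\<close>)
  then show ?thesis
    by (auto simp: Hausdorff_space_def topspace_germ_topology[OF L(1)] sep_def)
qed

text \<open>In the last conjunct, equality of the two limits is expressed by a common limit
  \<open>x\<close>. This is the same thing, since limits exist and are unique along a proper filter
  in a Hausdorff space.\<close>

theorem theorem5:
  fixes L :: "'l set" and F :: "'l filter"
  assumes "infinite L"
    and "free_ultrafilter_on L F"
  shows "\<exists>(RL :: ('l \<times> real + ('l \<Rightarrow> real) set) topology).
    Hausdorff_space RL \<and>
    Inl ` (L \<times> (UNIV :: real set)) \<subseteq> topspace RL \<and>
    topspace RL = RL closure_of (Inl ` (L \<times> (UNIV :: real set))) \<and>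
    (\<exists>\<iota> :: real \<Rightarrow> 'l \<times> real + ('l \<Rightarrow> real) set.
       inj \<iota> \<and> range \<iota> \<subseteq> topspace RL \<and>
       (\<forall>c. limitin RL (\<lambda>l. Inl (l, c)) (\<iota> c) F)) \<and>
    (\<forall>\<phi> :: 'l \<Rightarrow> real. \<exists>x. limitin RL (\<lambda>l. Inl (l, \<phi> l)) x F) \<and>
    (\<forall>\<phi> \<psi> :: 'l \<Rightarrow> real.
       eventually (\<lambda>l. \<phi> l = \<psi> l) F \<longleftrightarrow>
       (\<exists>x. limitin RL (\<lambda>l. Inl (l, \<phi> l)) x F \<and> limitin RL (\<lambda>l. Inl (l, \<psi> l)) x F))"
proof -
  let ?X = "germ_topology L F :: ('l \<times> real + ('l \<Rightarrow> real) set) topology"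
  \<comment> \<open>The reals enter as germs of constant functions, as in the diagonal embedding
    into an ultrapower.\<close>
  let ?\<iota> = "\<lambda>c :: real. Inr (germ F (\<lambda>_. c)) :: 'l \<times> real + ('l \<Rightarrow> real) set"
  have F: "F \<noteq> bot" "F \<le> principal L"
    using assms(2) by (auto simp: free_ultrafilter_on_def)
  note top = topspace_germ_topology[OF F(2)]
  note lim = limitin_germ[OF F(2)]
  have Hausdorff: "Hausdorff_space ?X"
    by (rule Hausdorff_germ_topology[OF assms(2)])
  have eq_iff: "eventually (\<lambda>l. \<phi> l = \<psi> l) F \<longleftrightarrow>
      (\<exists>x. limitin ?X (\<lambda>l. Inl (l, \<phi> l)) x F \<and> limitin ?X (\<lambda>l. Inl (l, \<psi> l)) x F)" for \<phi> \<psi>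
  proof
    assume "eventually (\<lambda>l. \<phi> l = \<psi> l) F"
    then have "germ F \<phi> = germ F \<psi>" by (simp add: germ_eq_iff)
    then show "\<exists>x. limitin ?X (\<lambda>l. Inl (l, \<phi> l)) x F \<and> limitin ?X (\<lambda>l. Inl (l, \<psi> l)) x F"
      using lim by metis
  next
    assume "\<exists>x. limitin ?X (\<lambda>l. Inl (l, \<phi> l)) x F \<and> limitin ?X (\<lambda>l. Inl (l, \<psi> l)) x F"
    then obtain x where
      "limitin ?X (\<lambda>l. Inl (l, \<phi> l)) x F" "limitin ?X (\<lambda>l. Inl (l, \<psi> l)) x F" by blast
    \<comment> \<open>By uniqueness of limits, \<open>x\<close> must be the limit already known for
      each graph, namely its germ.\<close>
    then have "x = Inr (germ F \<phi>)" "x = Inr (germ F \<psi>)"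
      using limitin_Hausdorff_unique[OF _ lim F(1) Hausdorff] by blast+
    then show "eventually (\<lambda>l. \<phi> l = \<psi> l) F" by (simp flip: germ_eq_iff)
  qed
  \<comment> \<open>Equality of two constants does not depend on \<open>l\<close>, so as
    \<open>F \<noteq> bot\<close> it holds eventually only if it holds outright.\<close>
  have inj: "inj ?\<iota>"
    using F(1) by (auto simp: inj_def germ_eq_iff eventually_const)
  have range: "range ?\<iota> \<subseteq> topspace ?X"
    by (auto simp: top germ_space_def)
  show ?thesis
  proof (intro exI[of _ ?X] conjI allI)
    show "Inl ` (L \<times> UNIV) \<subseteq> topspace ?X"
      by (simp add: top germ_space_def)
    show "topspace ?X = ?X closure_of (Inl ` (L \<times> UNIV))"
      by (simp add: top closure_of_germ_topology[OF F])
    show "\<exists>\<iota>. inj \<iota> \<and> range \<iota> \<subseteq> topspace ?X \<and>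
        (\<forall>c. limitin ?X (\<lambda>l. Inl (l, c)) (\<iota> c) F)"
      using inj range lim[of "\<lambda>_. c" for c] by (intro exI[of _ ?\<iota>] conjI allI)
    show "\<exists>x. limitin ?X (\<lambda>l. Inl (l, \<phi> l)) x F" for \<phi>
      using lim by blast
  qed (fact Hausdorff eq_iff)+
qed

end
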